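(* Let $\mathcal{H}$ be a separable complex Hilbert space. Suppose that $T \in \mathcal{B}(\mathcal{H})$ and that every half-space of $\mathcal{H}$ is almost-invariant for $T$. Then $T = \alpha I + H$ for some $\alpha \in \mathbb{C}$ and some finite-rank operator $H \in \mathcal{B}(\mathcal{H})$.
   Context: $\mathcal{B}(\mathcal{H})$ denotes the bounded linear operators on $\mathcal{H}$. All subspaces are assumed to be norm-closed. A half-space of $\mathcal{H}$ is a subspace of infinite dimension and infinite codimension. A subspace $\mathcal{Y}$ is almost-invariant for $T$ if there is a finite-dimensional subspace $\mathcal{M}$ of $\mathcal{H}$ with $T\mathcal{Y} \subseteq \mathcal{Y} + \mathcal{M}$. *)

theory Defs
  imports "HOL-Analysis.Analysis" "HOL-Library.Set_Algebras"
begin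

class complex_vector = real_vector +
  fixes scaleC :: "complex \<Rightarrow> 'a \<Rightarrow> 'a"  (infixr \<open>*\<^sub>C\<close> 75)
  assumes scaleC_of_real: "of_real r *\<^sub>C x = r *\<^sub>R x"
    and scaleC_add_right: "a *\<^sub>C (x + y) = a *\<^sub>C x + a *\<^sub>C y"
    and scaleC_add_left: "(a + b) *\<^sub>C x = a *\<^sub>C x + b *\<^sub>C x"
    and scaleC_scaleC: "a *\<^sub>C b *\<^sub>C x = (a * b) *\<^sub>C x"
    and scaleC_one: "1 *\<^sub>C x = x"

global_interpretation complex_vector:
  vector_space "scaleC :: complex \<Rightarrow> 'a \<Rightarrow> 'a::complex_vector"
  defines csubspace_raw_def: csubspace = complex_vector.subspace
    and cspan_raw_def: cspan = complex_vector.span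
  by unfold_locales (simp_all add: scaleC_add_right scaleC_add_left scaleC_scaleC scaleC_one)

text \<open>
  The real inner product of the underlying real Hilbert space is the real part of the complex one,
  so that norm, metric and topology are those of \<^class>\<open>real_inner\<close>. Together with conjugate
  symmetry this makes \<open>cinner\<close> positive definite and the norm the one it induces, as
  the two lemmas below confirm.
\<close>

class complex_hilbert_space = complex_vector + real_inner + complete_space +
  fixes cinner :: "'a \<Rightarrow> 'a \<Rightarrow> complex"
  assumes cinner_commute: "cinner x y = cnj (cinner y x)"
    and cinner_add_left: "cinner (x + y) z = cinner x z + cinner y z"
    and cinner_scaleC_left: "cinner (a *\<^sub>C x) y = a * cinner x y"
    and inner_eq_Re_cinner: "inner x y = Re (cinner x y)"

lemma cinner_self: "cinner x x = of_real ((norm x)\<^sup>2)"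
  for x :: "'a::complex_hilbert_space"
proof -
  have "Im (cinner x x) = 0"
    using arg_cong[OF cinner_commute[of x x], of Im] by simp
  then show ?thesis
    by (simp add: complex_eq_iff power2_norm_eq_inner inner_eq_Re_cinner)
qed

lemma cinner_self_eq_0_iff: "cinner x x = 0 \<longleftrightarrow> x = 0"
  for x :: "'a::complex_hilbert_space"
  by (simp add: cinner_self)

definition bounded_clinear :: "('a::complex_hilbert_space \<Rightarrow> 'a) \<Rightarrow> bool" where
  "bounded_clinear T \<longleftrightarrow>
    Vector_Spaces.linear scaleC scaleC T \<and> (\<exists>K. \<forall>x. norm (T x) \<le> K * norm x)"

definition finite_cdim :: "'a::complex_vector set \<Rightarrow> bool" where
  "finite_cdim Y \<longleftrightarrow> (\<exists>B. finite B \<and> Y = cspan B)"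

text \<open>
  The quotient by \<open>Y\<close> is finite-dimensional iff it is spanned by the cosets of the members of some
  finite set \<open>B\<close>, that is, iff every vector is congruent modulo \<open>Y\<close> to a combination of \<open>B\<close>.
\<close>

definition finite_ccodim :: "'a::complex_vector set \<Rightarrow> bool" where
  "finite_ccodim Y \<longleftrightarrow> (\<exists>B. finite B \<and> Y + cspan B = UNIV)"

definition half_space :: "'a::complex_hilbert_space set \<Rightarrow> bool" where
  "half_space Y \<longleftrightarrow> csubspace Y \<and> closed Y \<and> \<not> finite_cdim Y \<and> \<not> finite_ccodim Y"

text \<open>
  \<open>M\<close> is not required to be closed, since finite-dimensional subspaces always are.
\<close>

definition almost_invariant ::
    "('a::complex_hilbert_space \<Rightarrow> 'a) \<Rightarrow> 'a set \<Rightarrow> bool" where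
  "almost_invariant T Y \<longleftrightarrow> (\<exists>M. csubspace M \<and> finite_cdim M \<and> T ` Y \<subseteq> Y + M)"

definition finite_rank :: "('a::complex_hilbert_space \<Rightarrow> 'a) \<Rightarrow> bool" where
  "finite_rank T \<longleftrightarrow> finite_cdim (range T)"

end

theory Submission imports Defs begin

text \<open>
  The proof is by contraposition. Suppose that \<open>T\<close> is not a finite-rank perturbation of a scalar.
  If \<open>F\<close> is a finite-dimensional subspace and \<open>G\<close> a subspace of finite codimension, then some
  \<open>x \<in> G\<close> satisfies \<open>T x \<notin> F + \<complex> x\<close>: otherwise \<open>T\<close> would act on \<open>G\<close> modulo \<open>F\<close> by sending every
  vector to a multiple of itself, hence as a scalar. This yields, recursively, sequences \<open>x\<close> and
  \<open>y\<close> such that \<open>x i\<close> is orthogonal to \<open>y j\<close> for all \<open>i\<close> and \<open>j\<close>, while the matrix of the inner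
  products of \<open>T (x i)\<close> with \<open>y j\<close> is triangular with nonzero diagonal. Let \<open>Y\<close> be the orthogonal
  complement of all the \<open>y j\<close>. The matrix has infinite rank, so \<open>T\<close> does not map \<open>Y\<close> into
  \<open>Y + M\<close> for any finite-dimensional \<open>M\<close>. In particular \<open>Y\<close> is a half-space, because a subspace
  of finite dimension or codimension is almost-invariant for every operator.
\<close>

section \<open>Sesquilinearity and the norm of scalar multiples\<close>

lemma cinner_zero_left [simp]: "cinner 0 y = 0"
  for y :: "'a::complex_hilbert_space"
  using cinner_add_left[of 0 0 y] by simp

lemma cinner_diff_left: "cinner (x - y) z = cinner x z - cinner y z"
  for x :: "'a::complex_hilbert_space"
  using cinner_add_left[of "x - y" y z] by simp

lemma cinner_add_right: "cinner x (y + z) = cinner x y + cinner x z"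
  for x :: "'a::complex_hilbert_space"
  by (metis cinner_add_left cinner_commute complex_cnj_add)

lemma cinner_scaleC_right: "cinner x (a *\<^sub>C y) = cnj a * cinner x y"
  for x :: "'a::complex_hilbert_space"
  by (metis cinner_commute cinner_scaleC_left complex_cnj_mult)

lemma cinner_eq_0_commute: "cinner x y = 0 \<longleftrightarrow> cinner y x = 0"
  for x :: "'a::complex_hilbert_space"
  by (metis cinner_commute complex_cnj_zero)

lemma Im_cinner: "Im (cinner x y) = inner x (\<i> *\<^sub>C y)"
  for x :: "'a::complex_hilbert_space"
  by (simp add: inner_eq_Re_cinner cinner_scaleC_right)

lemma norm_scaleC: "norm (a *\<^sub>C x) = cmod a * norm x"
  for x :: "'a::complex_hilbert_space"
proof -
  have "complex_of_real ((norm (a *\<^sub>C x))\<^sup>2) = cnj a * (a * cinner x x)"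
    by (simp only: cinner_self[symmetric] cinner_scaleC_left cinner_scaleC_right)
  also have "\<dots> = complex_of_real ((cmod a * norm x)\<^sup>2)"
    by (simp add: cinner_self power_mult_distrib mult_ac flip: complex_norm_square)
  finally have "(norm (a *\<^sub>C x))\<^sup>2 = (cmod a * norm x)\<^sup>2"
    by (simp only: of_real_eq_iff)
  then show ?thesis
    by (simp add: power2_eq_iff_nonneg)
qed

section \<open>Orthogonal complements and projections onto finite-dimensional subspaces\<close>

lemma csubspace_orthogonal_complement: "csubspace {v. \<forall>b\<in>B. cinner v b = 0}"
  for B :: "'a::complex_hilbert_space set"
  by (auto simp: complex_vector.subspace_def cinner_add_left cinner_scaleC_left)

text \<open>Real and imaginary parts of \<open>cinner v b\<close> are real inner products of
  \<open>v\<close> with \<open>b\<close> and \<open>\<i> *\<^sub>C b\<close>, hence continuous in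
  \<open>v\<close>.\<close>

lemma closed_orthogonal_complement: "closed {v. \<forall>b\<in>B. cinner v b = 0}"
  for B :: "'a::complex_hilbert_space set"
proof -
  have "{v. \<forall>b\<in>B. cinner v b = 0} = (\<Inter>b\<in>B. {v. inner v b = 0} \<inter> {v. inner v (\<i> *\<^sub>C b) = 0})"
    by (auto simp: complex_eq_iff Im_cinner inner_eq_Re_cinner[symmetric])
  also have "closed \<dots>"
    by (intro closed_INT ballI closed_Int closed_Collect_eq continuous_intros)
  finally show ?thesis .
qed

lemma cinner_cspan_left:
  fixes y :: "'a::complex_hilbert_space"
  assumes "v \<in> cspan B" and "\<And>b. b \<in> B \<Longrightarrow> cinner b y = 0"
  shows "cinner v y = 0"
proof -
  have "cspan B \<subseteq> {v. \<forall>b\<in>{y}. cinner v b = 0}"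
    by (rule complex_vector.span_minimal[OF _ csubspace_orthogonal_complement]) (use assms(2) in auto)
  then show ?thesis using assms(1) by auto
qed

lemma orthogonal_projection_exists:
  fixes v :: "'a::complex_hilbert_space"
  assumes "finite B"
  shows "\<exists>s\<in>cspan B. \<forall>b\<in>B. cinner (v - s) b = 0"
  using assms
proof (induction B arbitrary: v rule: finite_induct)
  case empty
  then show ?case by (auto intro: complex_vector.span_zero)
next
  case (insert c B)
  obtain s where s: "s \<in> cspan B" "\<And>b. b \<in> B \<Longrightarrow> cinner (c - s) b = 0"
    using insert.IH[of c] by blast
  obtain t where t: "t \<in> cspan B" "\<And>b. b \<in> B \<Longrightarrow> cinner (v - t) b = 0"
    using insert.IH[of v] by blast
  \<comment> \<open>A Gram-Schmidt step: \<open>c'\<close> is the part of \<open>c\<close>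
    orthogonal to \<open>B\<close>, and \<open>w\<close> is what remains of \<open>v\<close> after
    projecting onto \<open>B\<close> and then \<open>c'\<close>. If \<open>c' = 0\<close>, the
    default value \<open>k = 0\<close> of the division is harmless.\<close>
  define c' where "c' = c - s"
  define k where "k = cinner (v - t) c' / cinner c' c'"
  define w where "w = v - t - k *\<^sub>C c'"
  have wB: "cinner w b = 0" if "b \<in> B" for b
    using s t that by (simp add: w_def c'_def cinner_diff_left cinner_scaleC_left)
  have "cinner w c' = 0"
  proof (cases "c' = 0")
    case True
    then show ?thesis by (subst cinner_eq_0_commute) simp
  next
    case False
    then show ?thesis
      by (simp add: w_def k_def cinner_diff_left cinner_scaleC_left cinner_self_eq_0_iff)
  qed
  moreover have "cinner w s = 0"
    using cinner_cspan_left[OF s(1)] wB cinner_eq_0_commute by metis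
  ultimately have "cinner w c = 0"
    using cinner_add_right[of w c' s] by (simp add: c'_def)
  moreover have "t + k *\<^sub>C c' \<in> cspan (insert c B)"
  proof -
    have "cspan B \<subseteq> cspan (insert c B)"
      by (intro complex_vector.span_mono subset_insertI)
    then show ?thesis
      unfolding c'_def
      using s(1) t(1) complex_vector.span_base[of c "insert c B"]
      by (intro complex_vector.span_add complex_vector.span_scale complex_vector.span_diff) auto
  qed
  ultimately show ?case
    using wB by (intro bexI[of _ "t + k *\<^sub>C c'"]) (auto simp: w_def diff_diff_eq)
qed

section \<open>Operators that are scalar modulo a subspace, dimension bounds and finite rank\<close>

lemma scalar_modulo_subspace:
  assumes "Vector_Spaces.linear scaleC scaleC T" and F: "csubspace F" and G: "csubspace G"
    and eig: "\<And>x. x \<in> G \<Longrightarrow> \<exists>c. T x - c *\<^sub>C x \<in> F"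
  shows "\<exists>\<alpha>. \<forall>x\<in>G. T x - \<alpha> *\<^sub>C x \<in> F"
proof (cases "G \<subseteq> F")
  case True
  have "T x \<in> F" if x: "x \<in> G" for x
  proof -
    obtain c where "T x - c *\<^sub>C x \<in> F" using eig x by blast
    moreover have "c *\<^sub>C x \<in> F"
      using True x F by (auto intro: complex_vector.subspace_scale)
    ultimately show ?thesis
      using complex_vector.subspace_add[OF F] by force
  qed
  then show ?thesis by (intro exI[of _ 0]) simp
next
  case False
  interpret T: Vector_Spaces.linear scaleC scaleC T by fact
  \<comment> \<open>Every vector of \<open>G\<close> is an eigenvector modulo \<open>F\<close>. The
    vector \<open>z\<close> fixes the eigenvalue; any other \<open>x\<close> is compared with it
    through the sum \<open>x + z\<close>.\<close>
  obtain z \<alpha> where z: "z \<in> G" "z \<notin> F" and \<alpha>: "T z - \<alpha> *\<^sub>C z \<in> F"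
    using False eig by blast
  note F_add = complex_vector.subspace_add[OF F] and F_diff = complex_vector.subspace_diff[OF F]
    and F_scale = complex_vector.subspace_scale[OF F]
  have cancel: "v \<in> F" if "a *\<^sub>C v \<in> F" "a \<noteq> 0" for a v
    using F_scale[OF that(1), of "inverse a"] that(2) by simp
  have "T x - \<alpha> *\<^sub>C x \<in> F" if x: "x \<in> G" for x
  proof -
    obtain b where b: "T x - b *\<^sub>C x \<in> F" using eig x by blast
    obtain c where c: "T (x + z) - c *\<^sub>C (x + z) \<in> F"
      using eig x z complex_vector.subspace_add[OF G] by blast
    have "(T x - b *\<^sub>C x) + (T z - \<alpha> *\<^sub>C z) - (T (x + z) - c *\<^sub>C (x + z)) \<in> F"
      by (intro F_add F_diff b \<alpha> c)
    then have rel: "(c - b) *\<^sub>C x + (c - \<alpha>) *\<^sub>C z \<in> F"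
      by (simp add: T.add complex_vector.scale_right_distrib complex_vector.scale_left_diff_distrib
          algebra_simps)
    show ?thesis
    proof (cases "c = b")
      case True
      then have "c = \<alpha>" using rel cancel[of "c - \<alpha>" z] z by auto
      then show ?thesis using b True by simp
    next
      case False
      \<comment> \<open>Now \<open>x\<close> is a multiple of \<open>z\<close> modulo
        \<open>F\<close>. The vector \<open>x + d *\<^sub>C z\<close> lies in both \<open>F\<close>
        and \<open>G\<close>, so \<open>eig\<close> puts its image in \<open>F\<close>, although
        \<open>F\<close> is not assumed invariant.\<close>
      define d where "d = (c - \<alpha>) / (c - b)"
      have "(c - b) *\<^sub>C (x + d *\<^sub>C z) \<in> F"
        using rel False by (simp add: d_def complex_vector.scale_right_distrib)
      then have f: "x + d *\<^sub>C z \<in> F" (is "?f \<in> F") using cancel False by simp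
      moreover have "?f \<in> G"
        using x z G by (simp add: complex_vector.subspace_add complex_vector.subspace_scale)
      ultimately obtain e where "T ?f - e *\<^sub>C ?f \<in> F" using eig by blast
      then have "T ?f \<in> F" using F_add[OF _ F_scale[OF f, of e]] by force
      then have "T ?f - \<alpha> *\<^sub>C ?f - d *\<^sub>C (T z - \<alpha> *\<^sub>C z) \<in> F"
        using F_diff F_scale f \<alpha> by blast
      then show ?thesis
        by (simp add: T.add T.scale complex_vector.scale_right_distrib
            complex_vector.scale_right_diff_distrib algebra_simps)
    qed
  qed
  then show ?thesis by blast
qed

lemma finite_cdim_if_subset_cspan:
  assumes "csubspace V" "finite C" "V \<subseteq> cspan C"
  shows "finite_cdim V"
proof -
  obtain B where B: "B \<subseteq> V" "\<not> complex_vector.dependent B" "V \<subseteq> cspan B"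
    using complex_vector.maximal_independent_subset[of V] by blast
  then have "finite B"
    using complex_vector.independent_span_bound[of C B] assms by auto
  moreover have "V = cspan B"
    using complex_vector.span_subspace[of B V] B assms(1) by simp
  ultimately show ?thesis unfolding finite_cdim_def by blast
qed

text \<open>Pairing with \<open>y n\<close> annihilates every \<open>m i\<close> with
  \<open>i < n\<close> but not \<open>m n\<close>. So the \<open>m i\<close> are independent, and
  \<open>cspan C\<close> cannot contain more than \<open>card C\<close> of them.\<close>

lemma not_in_cspan_if_triangular:
  fixes m y :: "nat \<Rightarrow> 'a::complex_hilbert_space"
  assumes "finite C" and lower: "\<And>i j. i < j \<Longrightarrow> cinner (m i) (y j) = 0"
    and diag: "\<And>j. cinner (m j) (y j) \<noteq> 0"
  shows "\<exists>i. m i \<notin> cspan C"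
proof (rule ccontr)
  assume "\<nexists>i. m i \<notin> cspan C"
  then have sub: "m ` {..<n} \<subseteq> cspan C" for n by blast
  have new: "m n \<notin> cspan (m ` {..<n})" for n
    using cinner_cspan_left[of "m n" "m ` {..<n}" "y n"] lower diag by auto
  have "\<not> complex_vector.dependent (m ` {..<n}) \<and> card (m ` {..<n}) = n" for n
  proof (induction n)
    case 0
    then show ?case by (simp add: complex_vector.independent_empty)
  next
    case (Suc n)
    then show ?case
      using new[of n] complex_vector.span_base[of "m n" "m ` {..<n}"]
      by (auto simp: lessThan_Suc complex_vector.independent_insert)
  qed
  then have "n \<le> card C" for n
    using complex_vector.independent_span_bound[OF \<open>finite C\<close> _ sub[of n]] by metis
  then show False using Suc_n_not_le_n by blast
qed

text \<open>Projection splits each vector into a part orthogonal to \<open>B\<close>, which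
  \<open>T - \<alpha>\<close> sends into \<open>cspan A\<close>, and a part in
  \<open>cspan B\<close>, whose image is spanned by finitely many vectors.\<close>

lemma finite_rank_perturbation_of_scalar:
  assumes T: "bounded_clinear T" and "finite A" "finite B"
    and scal: "\<And>x. (\<forall>b\<in>B. cinner x b = 0) \<Longrightarrow> T x - \<alpha> *\<^sub>C x \<in> cspan A"
  shows "\<exists>H. bounded_clinear H \<and> finite_rank H \<and> T = (\<lambda>x. \<alpha> *\<^sub>C x + H x)"
proof -
  interpret T: Vector_Spaces.linear scaleC scaleC T
    using T by (simp add: bounded_clinear_def)
  define H where "H x = T x - \<alpha> *\<^sub>C x" for x
  have H: "Vector_Spaces.linear scaleC scaleC H"
    by unfold_locales
      (simp_all add: H_def T.add T.scale complex_vector.scale_right_distrib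
        complex_vector.scale_right_diff_distrib mult.commute)
  interpret H: Vector_Spaces.linear scaleC scaleC H by fact
  obtain K where K: "\<And>x. norm (T x) \<le> K * norm x"
    using T by (auto simp: bounded_clinear_def)
  have "norm (H x) \<le> (K + cmod \<alpha>) * norm x" for x
    using norm_triangle_ineq4[of "T x" "\<alpha> *\<^sub>C x"] K[of x]
    by (simp add: H_def norm_scaleC algebra_simps)
  then have "bounded_clinear H" using H by (auto simp: bounded_clinear_def)
  moreover have "finite_rank H"
    unfolding finite_rank_def
  proof (rule finite_cdim_if_subset_cspan)
    show "csubspace (range H)"
      using H.subspace_image complex_vector.subspace_UNIV unfolding csubspace_raw_def by blast
    show "finite (A \<union> H ` B)" using assms by simp
    show "range H \<subseteq> cspan (A \<union> H ` B)"
    proof (rule image_subsetI)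
      fix v
      obtain s where s: "s \<in> cspan B" "\<forall>b\<in>B. cinner (v - s) b = 0"
        using orthogonal_projection_exists[OF \<open>finite B\<close>] by blast
      have "H (v - s) \<in> cspan A" using scal s(2) by (simp add: H_def)
      moreover have "H s \<in> cspan (H ` B)" using s(1) by (simp add: H.span_image cspan_raw_def)
      ultimately have "H (v - s) + H s \<in> cspan (A \<union> H ` B)"
        by (intro complex_vector.span_add) (meson Un_upper1 Un_upper2 complex_vector.span_mono in_mono)+
      then show "H v \<in> cspan (A \<union> H ` B)" by (simp add: H.diff)
    qed
  qed
  moreover have "T = (\<lambda>x. \<alpha> *\<^sub>C x + H x)" by (simp add: H_def)
  ultimately show ?thesis by blast
qed

section \<open>Construction of the triangular sequences\<close>

lemma exists_triangular_step:
  fixes T :: "'a::complex_hilbert_space \<Rightarrow> 'a"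
  assumes T: "bounded_clinear T"
    and neg: "\<nexists>\<alpha> H. bounded_clinear H \<and> finite_rank H \<and> T = (\<lambda>x. \<alpha> *\<^sub>C x + H x)"
    and "finite A" "finite B"
  shows "\<exists>x y. (\<forall>b\<in>B. cinner x b = 0) \<and> (\<forall>a\<in>A. cinner a y = 0) \<and>
           cinner x y = 0 \<and> cinner (T x) y \<noteq> 0"
proof -
  have lin: "Vector_Spaces.linear scaleC scaleC T"
    using T by (simp add: bounded_clinear_def)
  define G where "G = {x. \<forall>b\<in>B. cinner x b = 0}"
  obtain x where x: "x \<in> G" "\<And>c. T x - c *\<^sub>C x \<notin> cspan A"
  proof (rule ccontr)
    assume "\<not> thesis"
    with that have "\<exists>c. T x - c *\<^sub>C x \<in> cspan A" if "x \<in> G" for x using that by blast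
    then have "\<exists>\<alpha>. \<forall>x\<in>G. T x - \<alpha> *\<^sub>C x \<in> cspan A"
      by (intro scalar_modulo_subspace lin)
        (auto simp: G_def csubspace_orthogonal_complement)
    then show False
      using finite_rank_perturbation_of_scalar[OF T \<open>finite A\<close> \<open>finite B\<close>] neg
      unfolding G_def by blast
  qed
  \<comment> \<open>The residual \<open>y\<close> of \<open>T x\<close> after projection onto the
    span of \<open>x\<close> and \<open>A\<close> is nonzero by the choice of \<open>x\<close>, and
    its inner product with \<open>T x\<close> equals that with itself.\<close>
  obtain s where s: "s \<in> cspan (insert x A)" "\<forall>b\<in>insert x A. cinner (T x - s) b = 0"
    using orthogonal_projection_exists[of "insert x A" "T x"] \<open>finite A\<close> by blast
  define y where "y = T x - s"
  have orth: "cinner b y = 0" if "b \<in> insert x A" for b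
    using s(2) that cinner_eq_0_commute unfolding y_def by metis
  have "y \<noteq> 0"
    using s(1) x(2) by (auto simp: y_def complex_vector.span_insert)
  moreover have "cinner s y = 0" using cinner_cspan_left s(1) orth by metis
  ultimately have "cinner (T x) y \<noteq> 0"
    using cinner_add_left[of y s y] by (simp add: y_def cinner_self_eq_0_iff)
  then show ?thesis using x(1) orth unfolding G_def by blast
qed

lemma exists_triangular_sequences:
  fixes T :: "'a::complex_hilbert_space \<Rightarrow> 'a"
  assumes "bounded_clinear T"
    and "\<nexists>\<alpha> H. bounded_clinear H \<and> finite_rank H \<and> T = (\<lambda>x. \<alpha> *\<^sub>C x + H x)"
  obtains x y :: "nat \<Rightarrow> 'a" where "\<And>i j. cinner (x i) (y j) = 0"
    and "\<And>i j. i < j \<Longrightarrow> cinner (T (x i)) (y j) = 0" and "\<And>j. cinner (T (x j)) (y j) \<noteq> 0"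
proof -
  \<comment> \<open>\<open>P f n p\<close> says that \<open>p\<close> can be the \<open>n\<close>-th
    pair after \<open>f 0, ..., f (n - 1)\<close>. Orthogonality is imposed in both directions, so
    the later of two indices settles both orders; the images under \<open>T\<close> are constrained
    only on one side of the diagonal.\<close>
  define P where "P f n p \<longleftrightarrow>
      (\<forall>i<n. cinner (fst p) (snd (f i)) = 0 \<and> cinner (fst (f i)) (snd p) = 0 \<and>
             cinner (T (fst (f i))) (snd p) = 0) \<and>
      cinner (fst p) (snd p) = 0 \<and> cinner (T (fst p)) (snd p) \<noteq> 0"
    for f :: "nat \<Rightarrow> 'a \<times> 'a" and n p
  have "\<exists>f. \<forall>n. P f n (f n)"
  proof (rule dependent_wellorder_choice)
    show "P f n p = P g n p" if "\<And>i. i < n \<Longrightarrow> f i = g i" for p f g n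
      using that by (simp add: P_def)
    show "\<exists>p. P f n p" for n f
      using exists_triangular_step[OF assms, of
          "(\<lambda>i. fst (f i)) ` {..<n} \<union> (\<lambda>i. T (fst (f i))) ` {..<n}" "(\<lambda>i. snd (f i)) ` {..<n}"]
      by (simp add: P_def ball_Un) blast
  qed
  then obtain f where f: "\<And>n. P f n (f n)" by blast
  have "cinner (fst (f i)) (snd (f j)) = 0" for i j
    using f[of i] f[of j] by (cases i j rule: linorder_cases) (auto simp: P_def)
  then show thesis
    using f by (intro that[of "\<lambda>i. fst (f i)" "\<lambda>i. snd (f i)"]) (auto simp: P_def)
qed

section \<open>Almost-invariance and the contradiction\<close>

lemma almost_invariant_if_not_half_space:
  assumes T: "bounded_clinear T" and Y: "csubspace Y" "closed Y" "\<not> half_space Y"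
  shows "almost_invariant T Y"
proof -
  interpret T: Vector_Spaces.linear scaleC scaleC T
    using T by (simp add: bounded_clinear_def)
  consider "finite_cdim Y" | "finite_ccodim Y" using Y by (auto simp: half_space_def)
  \<comment> \<open>For finite dimension, \<open>C\<close> spans the image of \<open>Y\<close>; for
    finite codimension, it completes \<open>Y\<close> to the whole space.\<close>
  then have "\<exists>C. finite C \<and> T ` Y \<subseteq> Y + cspan C"
  proof cases
    case 1
    then obtain B where "finite B" "Y = cspan B" by (auto simp: finite_cdim_def)
    then have "T ` Y \<subseteq> Y + cspan (T ` B)"
      using T.span_image[of B] set_zero_plus2[OF complex_vector.subspace_0[OF Y(1)]]
      by (simp add: cspan_raw_def)
    with \<open>finite B\<close> show ?thesis by blast
  next
    case 2
    then show ?thesis by (auto simp: finite_ccodim_def)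
  qed
  then show ?thesis
    unfolding almost_invariant_def finite_cdim_def using complex_vector.subspace_span by blast
qed

theorem corollary4p16:
  fixes T :: "'a::complex_hilbert_space \<Rightarrow> 'a"
  assumes "separable_space (euclidean :: 'a topology)"
    and "bounded_clinear T"
    and "\<And>Y. half_space Y \<Longrightarrow> almost_invariant T Y"
  shows "\<exists>\<alpha> H. bounded_clinear H \<and> finite_rank H \<and> T = (\<lambda>x. \<alpha> *\<^sub>C x + H x)"
proof (rule ccontr)
  assume "\<nexists>\<alpha> H. bounded_clinear H \<and> finite_rank H \<and> T = (\<lambda>x. \<alpha> *\<^sub>C x + H x)"
  then obtain x y :: "nat \<Rightarrow> 'a" where xy: "\<And>i j. cinner (x i) (y j) = 0"
    and tri: "\<And>i j. i < j \<Longrightarrow> cinner (T (x i)) (y j) = 0" "\<And>j. cinner (T (x j)) (y j) \<noteq> 0"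
    by (rule exists_triangular_sequences[OF assms(2)]) blast
  define Y where "Y = {v. \<forall>b\<in>range y. cinner v b = 0}"
  have "almost_invariant T Y"
    using assms(3) almost_invariant_if_not_half_space[OF assms(2)]
      csubspace_orthogonal_complement closed_orthogonal_complement unfolding Y_def by blast
  then obtain C where C: "finite C" "T ` Y \<subseteq> Y + cspan C"
    by (auto simp: almost_invariant_def finite_cdim_def)
  have "\<exists>m\<in>cspan C. T (x i) - m \<in> Y" for i
  proof -
    have "T (x i) \<in> Y + cspan C" using C(2) xy by (auto simp: Y_def)
    then show ?thesis by (metis add_diff_cancel_right' set_plus_elim)
  qed
  then obtain m where m: "\<And>i. m i \<in> cspan C" "\<And>i. T (x i) - m i \<in> Y" by metis
  \<comment> \<open>Members of \<open>Y\<close> are invisible to every \<open>y j\<close>, so the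
    triangular matrix is inherited by the vectors \<open>m i\<close> of the finite-dimensional
    \<open>cspan C\<close>.\<close>
  have "cinner (m i) (y j) = cinner (T (x i)) (y j)" for i j
    using m(2)[of i] by (auto simp: Y_def cinner_diff_left)
  then show False
    using not_in_cspan_if_triangular[OF C(1), of m y] tri m(1) by auto
qed

end
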